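(* Let $L>0$, $T>0$, $g\in L^2(\mathbb R_+)$, and suppose that the function $r\mapsto e^{\frac r{4T}}g(r)\big/\ln\left(1+\frac{4T}r\right)$ belongs to $L^\infty(\mathbb R_+)$. Let $$\gamma_n=-\frac\pi{2^{2n+1}n!}\int_0^\infty r^ng(r)\,dr,\quad n\in\mathbb N_0=\{0,1,2,\dots\}.$$ Then $g\in\mathbf R_T^L$ if and only if there exists $u\in L^\infty(0,T)$ with $\|u\|_{L^\infty(0,T)}\le L$ such that $$\int_0^T\xi^nu(T-\xi)\,d\xi=\gamma_n\quad\text{for all }n\in\mathbb N_0.$$
   Context: $\mathbb R_+=(0,+\infty)$. $\mathbf R_T^L$ is the set of all functions $Y\in L^2(\mathbb R_+)$ for which there is $u\in L^\infty(0,T)$ with $\|u\|_{L^\infty(0,T)}\le L$ such that $$Y(r)=-\frac1\pi\int_0^T\frac1{2\xi}e^{-\frac r{4\xi}}u(T-\xi)\,d\xi,\quad r\in\mathbb R_+.$$ *)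

theory Defs
  imports "HOL-Analysis.Analysis" "HOL-Probability.Essential_Supremum"
begin

(* Elements of L^2 and L^infinity are represented by Lebesgue measurable real-valued
   functions on the whole line, of which only the values on S matter; equality of elements
   is equality almost everywhere on S. *)

definition L2_space :: "real set \<Rightarrow> (real \<Rightarrow> real) set" where
  "L2_space S = {f. f \<in> borel_measurable (lebesgue_on S) \<and>
                    integrable (lebesgue_on S) (\<lambda>x. (f x)\<^sup>2)}"

definition Linf_norm :: "real set \<Rightarrow> (real \<Rightarrow> real) \<Rightarrow> ereal" where
  "Linf_norm S f = esssup (lebesgue_on S) (\<lambda>x. ereal \<bar>f x\<bar>)"

definition Linf_space :: "real set \<Rightarrow> (real \<Rightarrow> real) set" where
  "Linf_space S = {f. f \<in> borel_measurable (lebesgue_on S) \<and> Linf_norm S f < \<infinity>}"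

(* The set R_T^L.  The representation of Y holds for almost every r > 0, since Y is an
   element of L^2; the set is thus closed under changing Y on a null set. *)
definition reachable :: "real \<Rightarrow> real \<Rightarrow> (real \<Rightarrow> real) set" where
  "reachable T L = {Y \<in> L2_space {0<..}.
     \<exists>u \<in> Linf_space {0<..<T}. Linf_norm {0<..<T} u \<le> ereal L \<and>
       (AE r in lebesgue_on {0<..}.
          Y r = - (1 / pi) * (LINT \<xi>|lebesgue_on {0<..<T}.
                  1 / (2 * \<xi>) * exp (- r / (4 * \<xi>)) * u (T - \<xi>)))}"

end

(* Write v(xi) = u(T - xi) and Y(r) = - 1/pi int_0^T e^(-r/(4 xi)) v(xi) / (2 xi) dxi.  By Fubini the
   n-th moment of Y is - n! 2^(2n+1)/pi int_0^T xi^n v(xi) dxi, so the moment conditions say that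
   h = g - Y has vanishing moments.  Both e^(a r) g and e^(a r) Y are integrable for a = 1/(8T),
   and this makes h determined by its moments: expanding e^(-a r/2) in a power series shows
   that e^(-a r/2) h again has vanishing moments, so by iteration h is orthogonal to all
   polynomials in e^(-a r/2), hence by Weierstrass to all continuous functions of it,
   and so h = 0 almost everywhere. *)
theory Submission
  imports Defs "HOL-Probability.Distributions"
begin

section \<open>Measurability of coordinates and bounds from the exponential series\<close>

text \<open>Registered for the \<open>measurable\<close> method: the source carries the Lebesgue
  sets, not the Borel sets, so even the bare variable must be recognised as Borel
  measurable.\<close>

lemma borel_measurable_ident_lebesgue_on [measurable (raw)]:
  "(\<lambda>x::real. x) \<in> borel_measurable (lebesgue_on S)"
  using id_borel_measurable_lebesgue_on[of S] by (simp add: id_def)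

lemma borel_measurable_fst_lebesgue_on [measurable]:
  "(\<lambda>p. fst p :: real) \<in> borel_measurable (lebesgue_on S \<Otimes>\<^sub>M N)"
  by (rule measurable_compose[OF measurable_fst borel_measurable_ident_lebesgue_on])

lemma borel_measurable_snd_lebesgue_on [measurable]:
  "(\<lambda>p. snd p :: real) \<in> borel_measurable (N \<Otimes>\<^sub>M lebesgue_on S)"
  by (rule measurable_compose[OF measurable_snd borel_measurable_ident_lebesgue_on])

lemma power_div_fact_le_exp:
  fixes x :: real
  assumes "0 \<le> x"
  shows "x ^ n / fact n \<le> exp x"
proof -
  have "(\<Sum>k\<in>{n}. x ^ k /\<^sub>R fact k) \<le> (\<Sum>k. x ^ k /\<^sub>R fact k)"
    by (rule sum_le_suminf) (use assms summable_exp_generic[of x] in auto)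
  then show ?thesis
    by (simp add: exp_def divide_inverse mult.commute)
qed

lemma power_le_exp:
  fixes a x :: real
  assumes "0 < a" "0 \<le> x"
  shows "x ^ n \<le> fact n / a ^ n * exp (a * x)"
  using power_div_fact_le_exp[of "a * x" n] assms by (simp add: field_simps)

text \<open>The bound is uniform in \<open>m\<close>, so it can serve as a majorant when the
  exponential series is integrated term by term.\<close>

lemma abs_exp_partial_sum_le:
  fixes x :: real
  shows "\<bar>\<Sum>k<m. x ^ k / fact k\<bar> \<le> exp \<bar>x\<bar>"
proof -
  have "\<bar>\<Sum>k<m. x ^ k / fact k\<bar> \<le> (\<Sum>k<m. \<bar>x ^ k / fact k\<bar>)"
    by (rule sum_abs)
  also have "\<dots> = (\<Sum>k<m. \<bar>x\<bar> ^ k /\<^sub>R fact k)"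
    by (intro sum.cong) (simp_all add: power_abs abs_mult divide_inverse mult.commute)
  also have "\<dots> \<le> (\<Sum>k. \<bar>x\<bar> ^ k /\<^sub>R fact k)"
    by (rule sum_le_suminf) (use summable_exp_generic[of "\<bar>x\<bar>"] in auto)
  finally show ?thesis
    by (simp add: exp_def)
qed

section \<open>Functions on the half-line that are orthogonal to all powers\<close>

text \<open>An exponential weight outgrows every power, so a single integrability hypothesis
  provides all moments.\<close>

lemma integrable_power_mult_of_exp:
  fixes h :: "real \<Rightarrow> real"
  assumes "0 < a" and h [measurable]: "h \<in> borel_measurable (lebesgue_on {0<..})"
    and int: "integrable (lebesgue_on {0<..}) (\<lambda>r. exp (a * r) * h r)"
  shows "integrable (lebesgue_on {0<..}) (\<lambda>r. r ^ n * h r)"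
proof (rule Bochner_Integration.integrable_bound)
  show "integrable (lebesgue_on {0<..}) (\<lambda>r. fact n / a ^ n * (exp (a * r) * h r))"
    using int by simp
  show "AE r in lebesgue_on {0<..}. norm (r ^ n * h r) \<le> norm (fact n / a ^ n * (exp (a * r) * h r))"
  proof (rule AE_I2)
    fix r :: real assume "r \<in> space (lebesgue_on {0<..})"
    then have "\<bar>r ^ n\<bar> * \<bar>h r\<bar> \<le> fact n / a ^ n * exp (a * r) * \<bar>h r\<bar>"
      using power_le_exp[OF assms(1), of r n] by (intro mult_right_mono) auto
    then show "norm (r ^ n * h r) \<le> norm (fact n / a ^ n * (exp (a * r) * h r))"
      using assms(1) by (simp add: abs_mult mult.assoc)
  qed
qed measurable

text \<open>Replacing \<open>exp (- a * r)\<close> by a partial sum of its power series leaves a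
  finite combination of moments of \<open>h\<close>, which is zero. Dominated convergence passes to
  the full series.\<close>

lemma moments_zero_exp_tilt:
  fixes h :: "real \<Rightarrow> real"
  assumes a: "0 < a" and h [measurable]: "h \<in> borel_measurable (lebesgue_on {0<..})"
    and int: "integrable (lebesgue_on {0<..}) (\<lambda>r. exp (2 * a * r) * h r)"
    and zero: "\<And>n. (LINT r|lebesgue_on {0<..}. r ^ n * h r) = 0"
  shows "(LINT r|lebesgue_on {0<..}. r ^ n * (exp (- a * r) * h r)) = 0"
proof -
  let ?N = "lebesgue_on {0<..} :: real measure"
  let ?S = "\<lambda>m r. (\<Sum>k<m. (- a * r) ^ k / fact k) * (r ^ n * h r)"
  have mom: "integrable ?N (\<lambda>r. r ^ k * h r)" for k
    by (rule integrable_power_mult_of_exp[where a = "2 * a"]) (use a int in auto)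
  have "(LINT r|?N. ?S m r) = 0" for m
  proof -
    have "(LINT r|?N. ?S m r) = (LINT r|?N. (\<Sum>k<m. (- a) ^ k / fact k * (r ^ (n + k) * h r)))"
      by (intro Bochner_Integration.integral_cong)
        (simp_all add: sum_distrib_right power_mult_distrib power_minus[of "a * _"] power_minus[of a] power_add,
          simp add: mult_ac)
    also have "\<dots> = (\<Sum>k<m. (- a) ^ k / fact k * (LINT r|?N. r ^ (n + k) * h r))"
      using mom by (subst Bochner_Integration.integral_sum) auto
    finally show ?thesis
      using zero by simp
  qed
  moreover have "(\<lambda>m. LINT r|?N. ?S m r) \<longlonglongrightarrow> (LINT r|?N. exp (- a * r) * (r ^ n * h r))"
  proof (rule integral_dominated_convergence)
    \<comment> \<open>The weight \<open>exp (2 * a * r)\<close> is spent in two halves: one factor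
      \<open>exp (a * r)\<close> bounds the partial sums, the other bounds
      \<open>r ^ n\<close>.\<close>
    let ?w = "\<lambda>r. fact n / a ^ n * (exp (2 * a * r) * \<bar>h r\<bar>)"
    have "integrable ?N (\<lambda>r. \<bar>exp (2 * a * r) * h r\<bar>)"
      using int by (rule integrable_abs)
    then show "integrable ?N ?w"
      by (simp add: abs_mult)
    show "AE r in ?N. norm (?S m r) \<le> ?w r" for m
    proof (rule AE_I2)
      fix r :: real assume "r \<in> space ?N"
      then have r: "0 \<le> r" by simp
      have "\<bar>\<Sum>k<m. (- a * r) ^ k / fact k\<bar> * (r ^ n * \<bar>h r\<bar>)
          \<le> exp (a * r) * (fact n / a ^ n * exp (a * r) * \<bar>h r\<bar>)"
        using abs_exp_partial_sum_le[of "- a * r" m] power_le_exp[OF a r, of n] a r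
        by (intro mult_mono) (auto simp: abs_mult)
      also have "\<dots> = ?w r"
        by (simp flip: exp_add)
      finally show "norm (?S m r) \<le> ?w r"
        using r by (simp add: abs_mult)
    qed
    show "AE r in ?N. (\<lambda>m. ?S m r) \<longlonglongrightarrow> exp (- a * r) * (r ^ n * h r)"
    proof (rule AE_I2)
      fix r
      have "(\<lambda>k. (- a * r) ^ k / fact k) sums exp (- a * r)"
        using exp_converges[of "- a * r"] by (simp add: divide_inverse mult.commute)
      then show "(\<lambda>m. ?S m r) \<longlonglongrightarrow> exp (- a * r) * (r ^ n * h r)"
        unfolding sums_def by (intro tendsto_mult tendsto_const)
    qed
  qed measurable
  ultimately have "(LINT r|?N. exp (- a * r) * (r ^ n * h r)) = 0"
    by (simp add: LIMSEQ_const_iff)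
  then show ?thesis
    by (simp add: mult_ac)
qed

text \<open>Each tilt preserves the vanishing of all moments, hence induction on \<open>m\<close>
  with \<open>n\<close> arbitrary. The same \<open>a\<close> works at every stage, because
  \<open>exp (- a * r) ^ m\<close> is at most 1 on the half-line and so does not harm the weighted
  integrability.\<close>

lemma moments_zero_exp_tilt_iterate:
  fixes h :: "real \<Rightarrow> real"
  assumes a: "0 < a" and h [measurable]: "h \<in> borel_measurable (lebesgue_on {0<..})"
    and int: "integrable (lebesgue_on {0<..}) (\<lambda>r. exp (2 * a * r) * h r)"
    and zero: "\<And>n. (LINT r|lebesgue_on {0<..}. r ^ n * h r) = 0"
  shows "(LINT r|lebesgue_on {0<..}. r ^ n * (exp (- a * r) ^ m * h r)) = 0"
proof (induction m arbitrary: n)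
  case 0
  then show ?case using zero by simp
next
  case (Suc m)
  have "(LINT r|lebesgue_on {0<..}. r ^ n * (exp (- a * r) * (exp (- a * r) ^ m * h r))) = 0"
  proof (rule moments_zero_exp_tilt[OF a _ _ Suc])
    show "integrable (lebesgue_on {0<..}) (\<lambda>r. exp (2 * a * r) * (exp (- a * r) ^ m * h r))"
    proof (rule Bochner_Integration.integrable_bound[OF int])
      show "AE r in lebesgue_on {0<..}. norm (exp (2 * a * r) * (exp (- a * r) ^ m * h r))
          \<le> norm (exp (2 * a * r) * h r)"
      proof (rule AE_I2)
        fix r :: real assume "r \<in> space (lebesgue_on {0<..})"
        then have "exp (- a * r) ^ m * \<bar>h r\<bar> \<le> 1 * \<bar>h r\<bar>"
          using a by (intro mult_right_mono power_le_one) auto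
        then show "norm (exp (2 * a * r) * (exp (- a * r) ^ m * h r)) \<le> norm (exp (2 * a * r) * h r)"
          by (simp add: abs_mult)
      qed
    qed measurable
  qed measurable
  then show ?case
    by (simp add: mult.assoc)
qed

text \<open>The values \<open>exp (- a * r)\<close> lie in \<open>{0..1}\<close>, where
  \<open>\<phi>\<close> is uniformly close to a polynomial. The polynomial contributes 0, and an
  error \<open>e\<close> changes the integral by at most \<open>e\<close> times the integral of
  \<open>\<bar>h r\<bar>\<close>.\<close>

lemma integral_continuous_exp_eq_zero:
  fixes h \<phi> :: "real \<Rightarrow> real"
  assumes a: "0 < a" and h [measurable]: "integrable (lebesgue_on {0<..}) h"
    and zero: "\<And>m. (LINT r|lebesgue_on {0<..}. exp (- a * r) ^ m * h r) = 0"
    and \<phi>: "continuous_on UNIV \<phi>"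
  shows "(LINT r|lebesgue_on {0<..}. \<phi> (exp (- a * r)) * h r) = 0"
proof -
  let ?N = "lebesgue_on {0<..} :: real measure"
  have hm [measurable]: "h \<in> borel_measurable ?N"
    using h by simp
  have [measurable]: "\<phi> \<in> borel_measurable borel"
    using \<phi> by (rule borel_measurable_continuous_onI)
  \<comment> \<open>Stated for a general \<open>\<psi>\<close>, as it is applied to
    \<open>\<phi>\<close>, to the approximating polynomial and to its monomials.\<close>
  have int: "integrable ?N (\<lambda>r. \<psi> (exp (- a * r)) * h r)"
    if \<psi>: "continuous_on UNIV \<psi>" for \<psi> :: "real \<Rightarrow> real"
  proof -
    have [measurable]: "\<psi> \<in> borel_measurable borel"
      using \<psi> by (rule borel_measurable_continuous_onI)
    have "compact (\<psi> ` {0..1})"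
      using \<psi> by (intro compact_continuous_image) (auto intro: continuous_on_subset)
    then obtain B where B: "\<And>x. x \<in> {0..1} \<Longrightarrow> norm (\<psi> x) \<le> B"
      by (meson bounded_iff compact_imp_bounded imageI)
    show ?thesis
    proof (rule Bochner_Integration.integrable_bound)
      show "integrable ?N (\<lambda>r. B * h r)"
        using h by simp
      show "AE r in ?N. norm (\<psi> (exp (- a * r)) * h r) \<le> norm (B * h r)"
      proof (rule AE_I2)
        fix r :: real assume "r \<in> space ?N"
        then have "\<bar>\<psi> (exp (- a * r))\<bar> \<le> \<bar>B\<bar>"
          using B[of "exp (- a * r)"] a by auto
        then show "norm (\<psi> (exp (- a * r)) * h r) \<le> norm (B * h r)"
          by (simp add: abs_mult mult_right_mono)
      qed
    qed measurable
  qed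
  have "\<bar>LINT r|?N. \<phi> (exp (- a * r)) * h r\<bar> \<le> e * (LINT r|?N. \<bar>h r\<bar>)" if "0 < e" for e
  proof -
    obtain p where p: "real_polynomial_function p" "\<And>x. x \<in> {0..1} \<Longrightarrow> \<bar>\<phi> x - p x\<bar> < e"
      using Stone_Weierstrass_real_polynomial_function[OF compact_Icc continuous_on_subset[OF \<phi> subset_UNIV] \<open>0 < e\<close>]
      by (metis (no_types))
    obtain c n where pc: "p = (\<lambda>x. \<Sum>i\<le>n. c i * x ^ i)"
      using p(1) real_polynomial_function_iff_sum by blast
    have cp: "continuous_on UNIV p"
      unfolding pc by (intro continuous_intros)
    have "(LINT r|?N. p (exp (- a * r)) * h r) = (LINT r|?N. (\<Sum>i\<le>n. c i * (exp (- a * r) ^ i * h r)))"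
      unfolding pc by (intro Bochner_Integration.integral_cong) (simp_all add: sum_distrib_right mult.assoc)
    also have "\<dots> = (\<Sum>i\<le>n. c i * (LINT r|?N. exp (- a * r) ^ i * h r))"
    proof (subst Bochner_Integration.integral_sum)
      fix i
      have "integrable ?N (\<lambda>r. exp (- a * r) ^ i * h r)"
        by (rule int[of "\<lambda>x. x ^ i"]) (intro continuous_intros)
      then show "integrable ?N (\<lambda>r. c i * (exp (- a * r) ^ i * h r))"
        by (rule integrable_mult_right)
    qed simp
    also have "\<dots> = 0"
      using zero by simp
    finally have "(LINT r|?N. \<phi> (exp (- a * r)) * h r)
        = (LINT r|?N. \<phi> (exp (- a * r)) * h r - p (exp (- a * r)) * h r)"
      using int[OF \<phi>] int[OF cp] by simp
    also have "\<bar>\<dots>\<bar> \<le> (LINT r|?N. \<bar>\<phi> (exp (- a * r)) * h r - p (exp (- a * r)) * h r\<bar>)"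
      by (rule integral_abs_bound)
    also have "\<dots> \<le> (LINT r|?N. e * \<bar>h r\<bar>)"
    proof (rule integral_mono_AE)
      show "AE r in ?N. \<bar>\<phi> (exp (- a * r)) * h r - p (exp (- a * r)) * h r\<bar> \<le> e * \<bar>h r\<bar>"
      proof (rule AE_I2)
        fix r :: real assume "r \<in> space ?N"
        then have "\<bar>\<phi> (exp (- a * r)) - p (exp (- a * r))\<bar> \<le> e"
          using p(2)[of "exp (- a * r)"] a by auto
        then show "\<bar>\<phi> (exp (- a * r)) * h r - p (exp (- a * r)) * h r\<bar> \<le> e * \<bar>h r\<bar>"
          by (simp add: mult_right_mono abs_mult flip: left_diff_distrib)
      qed
    qed (use int[OF \<phi>] int[OF cp] h in auto)
    finally show ?thesis by simp
  qed
  note bound = this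
  show ?thesis
  proof (rule ccontr)
    let ?A = "\<bar>LINT r|?N. \<phi> (exp (- a * r)) * h r\<bar>" and ?B = "LINT r|?N. \<bar>h r\<bar>"
    assume "(LINT r|?N. \<phi> (exp (- a * r)) * h r) \<noteq> 0"
    then have A: "0 < ?A" by simp
    have B: "0 \<le> ?B" by (intro Bochner_Integration.integral_nonneg) auto
    \<comment> \<open>This \<open>e\<close> makes the bound smaller than \<open>?A\<close> itself;
      the summand 1 keeps the denominator positive when \<open>?B\<close> is 0.\<close>
    have "?A \<le> ?A / (2 * (?B + 1)) * ?B"
      by (intro bound divide_pos_pos mult_pos_pos add_nonneg_pos A B) simp_all
    moreover have "x / (2 * (y + 1)) * y < x" if "0 < x" "0 \<le> y" for x y :: real
      using that by (simp add: field_simps add_nonneg_pos)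
    ultimately show False
      using A B by (meson not_le)
  qed
qed

text \<open>The open upper half-lines are stable under intersection and generate the Borel sets,
  while the sets over which \<open>f\<close> integrates to 0 form a Dynkin system. So the integral
  of \<open>f\<close> vanishes over every Borel set.\<close>

lemma AE_zero_of_integral_greaterThan:
  fixes f :: "real \<Rightarrow> real"
  assumes f: "integrable lborel f"
    and zero: "\<And>t. (LINT x:{t<..}|lborel. f x) = 0"
  shows "AE x in lborel. f x = 0"
proof (rule sigma_finite_measure.density_zero[OF sigma_finite_lborel f])
  have set_int: "set_integrable lborel A f" if "A \<in> sets borel" for A
    using integrable_mult_indicator[OF _ f, of A] that by (simp add: set_integrable_def)
  \<comment> \<open>The whole line is not among the generators, but complements need it. It is the
    limit of the half-lines \<open>{- real n<..}\<close>.\<close>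
  have total: "(LINT x:UNIV|lborel. f x) = 0"
  proof -
    have "(\<lambda>n. LINT x|lborel. indicator {- real n<..} x *\<^sub>R f x) \<longlonglongrightarrow> (LINT x|lborel. f x)"
    proof (rule integral_dominated_convergence[where w = "\<lambda>x. \<bar>f x\<bar>"])
      show "AE x in lborel. (\<lambda>n. indicator {- real n<..} x *\<^sub>R f x) \<longlonglongrightarrow> f x"
      proof (rule AE_I2)
        fix x :: real
        obtain k :: nat where "- x < real k"
          using reals_Archimedean2 by blast
        then have "eventually (\<lambda>n. indicator {- real n<..} x *\<^sub>R f x = f x) sequentially"
          by (intro eventually_sequentiallyI[of k]) (auto simp: indicator_def)
        then show "(\<lambda>n. indicator {- real n<..} x *\<^sub>R f x) \<longlonglongrightarrow> f x"
          by (rule tendsto_eventually)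
      qed
    qed (use f in \<open>auto simp: indicator_def\<close>)
    then show ?thesis
      using zero by (simp add: set_lebesgue_integral_def LIMSEQ_const_iff)
  qed
  have stable: "Int_stable (range greaterThan :: real set set)"
  proof (rule Int_stableI, elim rangeE)
    fix A B :: "real set" and s t assume "A = {s<..}" "B = {t<..}"
    then have "A \<inter> B = {max s t<..}" by auto
    then show "A \<inter> B \<in> range greaterThan" by simp
  qed
  fix A :: "real set"
  assume "A \<in> sets lborel"
  then have "A \<in> sigma_sets UNIV (range greaterThan)"
    by (simp add: borel_Ioi)
  with stable subset_UNIV[of "range greaterThan :: real set set", folded Pow_UNIV]
  show "(LINT x:A|lborel. f x) = 0"
  proof (induction rule: sigma_sets_induct_disjoint)
    case (basic A) then show ?case using zero by auto
  next
    case empty then show ?case by (simp add: set_lebesgue_integral_def)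
  next
    case (compl A)
    then have "A \<in> sets borel" by (simp add: borel_Ioi)
    then have "(LINT x:A \<union> (UNIV - A)|lborel. f x) = (LINT x:A|lborel. f x) + (LINT x:UNIV - A|lborel. f x)"
      by (intro set_integral_Un set_int) auto
    with compl total show ?case by simp
  next
    case (union A)
    have "(LINT x:(\<Union>i. A i)|lborel. f x) = (\<Sum>i. (LINT x:(A i)|lborel. f x))"
    proof (rule lebesgue_integral_countable_add)
      show A: "\<And>i. A i \<in> sets lborel" using union by (auto simp: borel_Ioi)
      show "\<And>i j. i \<noteq> j \<Longrightarrow> A i \<inter> A j = {}" using union by (simp add: disjoint_family_on_def)
      show "set_integrable lborel (\<Union> (range A)) f" using A by (intro set_int) auto
    qed
    with union show ?case by simp
  qed
qed


text \<open>Indicators of half-lines are pointwise limits of continuous functions of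
  \<open>exp (- b * r)\<close>. Hence all tail integrals of \<open>h\<close> vanish, which
  determines \<open>h\<close> almost everywhere.\<close>

lemma AE_zero_of_moments_zero:
  fixes h :: "real \<Rightarrow> real"
  assumes a: "0 < a" and h [measurable]: "h \<in> borel_measurable (lebesgue_on {0<..})"
    and int: "integrable (lebesgue_on {0<..}) (\<lambda>r. exp (a * r) * h r)"
    and zero: "\<And>n. (LINT r|lebesgue_on {0<..}. r ^ n * h r) = 0"
  shows "AE r in lebesgue_on {0<..}. h r = 0"
proof -
  let ?N = "lebesgue_on {0<..} :: real measure"
  \<comment> \<open>Tilting by \<open>b\<close> requires the weight \<open>exp (2 * b * r)\<close>,
    which is exactly the one given.\<close>
  define b where "b = a / 2"
  have b: "0 < b" using a by (simp add: b_def)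
  have inth: "integrable ?N h"
    using integrable_power_mult_of_exp[OF a h int, of 0] by simp
  have exp_zero: "(LINT r|?N. exp (- b * r) ^ m * h r) = 0" for m
    using moments_zero_exp_tilt_iterate[OF b h _ zero, of 0 m] int by (simp add: b_def)
  have tail: "(LINT r|?N. indicator {t<..} r * h r) = 0" for t
  proof -
    \<comment> \<open>A ramp in \<open>x\<close>: it is 0 for \<open>x\<close> at least
      \<open>exp (- b * t)\<close> and, for positive \<open>n\<close>, 1 once \<open>x\<close> is at
      most \<open>exp (- b * t) - 1 / n\<close>. As \<open>exp (- b * r)\<close> decreases in
      \<open>r\<close>, composition with it tends to the indicator of \<open>t < r\<close>,
      including the value 0 at \<open>r = t\<close>.\<close>
    define \<phi> where "\<phi> n x = min 1 (max 0 (real n * (exp (- b * t) - x)))" for n x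
    have cont: "continuous_on UNIV (\<phi> n)" for n
      unfolding \<phi>_def by (intro continuous_intros)
    have "(\<lambda>n. LINT r|?N. \<phi> n (exp (- b * r)) * h r) \<longlonglongrightarrow> (LINT r|?N. indicator {t<..} r * h r)"
    proof (rule integral_dominated_convergence[where w = "\<lambda>r. \<bar>h r\<bar>"])
      show "(\<lambda>r. \<phi> n (exp (- b * r)) * h r) \<in> borel_measurable ?N" for n
        unfolding \<phi>_def by measurable
      have "{t<..} \<inter> {0<..} \<in> sets ?N"
        by (intro sets_restrict_space_iff[THEN iffD2]) auto
      then show "(\<lambda>r. indicator {t<..} r * h r) \<in> borel_measurable ?N"
        by (intro borel_measurable_times borel_measurable_indicator') (auto simp: Int_def vimage_def conj_commute)
      show "AE r in ?N. norm (\<phi> n (exp (- b * r)) * h r) \<le> \<bar>h r\<bar>" for n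
      proof (rule AE_I2)
        fix r
        have "\<bar>\<phi> n (exp (- b * r))\<bar> \<le> 1" by (simp add: \<phi>_def)
        then show "norm (\<phi> n (exp (- b * r)) * h r) \<le> \<bar>h r\<bar>"
          by (simp add: abs_mult mult_left_le_one_le)
      qed
      show "AE r in ?N. (\<lambda>n. \<phi> n (exp (- b * r)) * h r) \<longlonglongrightarrow> indicator {t<..} r * h r"
      proof (rule AE_I2, rule tendsto_mult_right)
        fix r
        show "(\<lambda>n. \<phi> n (exp (- b * r))) \<longlonglongrightarrow> indicator {t<..} r"
        proof (cases "t < r")
          case True
          define d where "d = exp (- b * t) - exp (- b * r)"
          have "0 < d" using True b by (simp add: d_def)
          obtain k :: nat where k: "1 / d < real k" using reals_Archimedean2 by blast
          have "\<phi> n (exp (- b * r)) = 1" if "k \<le> n" for n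
          proof -
            have "1 / d \<le> real n" using k that by linarith
            then have "1 \<le> real n * d" using \<open>0 < d\<close> by (simp add: field_simps)
            then show ?thesis by (simp add: \<phi>_def d_def)
          qed
          then show ?thesis
            using True by (intro tendsto_eventually eventually_sequentiallyI[of k]) auto
        next
          case False
          then have "exp (- b * t) - exp (- b * r) \<le> 0" using b by simp
          then have "\<phi> n (exp (- b * r)) = 0" for n
            by (simp add: \<phi>_def mult_nonneg_nonpos)
          then show ?thesis using False by simp
        qed
      qed
    qed (use inth in auto)
    then show ?thesis
      using integral_continuous_exp_eq_zero[OF b inth exp_zero cont] by (simp add: LIMSEQ_const_iff)
  qed
  \<comment> \<open>The half-line criterion is stated for \<open>lborel\<close>, so \<open>h\<close>
    is extended by zero and then replaced by a Borel function \<open>f\<close> that agrees with the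
    extension almost everywhere.\<close>
  define F where "F = (\<lambda>x. if x \<in> {0<..} then h x else 0)"
  have F: "F \<in> borel_measurable lebesgue"
    unfolding F_def using h by (rule borel_measurable_if_I) simp
  then obtain f where f [measurable]: "f \<in> borel_measurable lborel" and Ff: "AE x in lborel. F x = f x"
    using completion_ex_borel_measurable_real by blast
  have Ff': "AE x in lebesgue. F x = f x"
    using Ff by (rule AE_completion)
  have f_leb: "f \<in> borel_measurable lebesgue"
    using f by (rule measurable_completion)
  have F_ind: "F = (\<lambda>x. indicator {0<..} x *\<^sub>R h x)"
    by (auto simp: F_def)
  have intF: "integrable lebesgue F"
    using inth unfolding F_ind by (subst (asm) integrable_restrict_space) auto
  have "integrable lebesgue f"
    using intF Ff' F by (subst (asm) integrable_cong_AE[where g = f]) (auto intro: f_leb)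
  then have intf: "integrable lborel f"
    by (simp add: integrable_completion)
  have "AE x in lborel. f x = 0"
  proof (rule AE_zero_of_integral_greaterThan[OF intf])
    fix t :: real
    have ind: "indicat_real {t<..} \<in> borel_measurable lebesgue"
      by (intro measurable_completion) measurable
    have "(LINT x:{t<..}|lborel. f x) = (LINT x|lebesgue. indicator {t<..} x * f x)"
      by (simp add: set_lebesgue_integral_def integral_completion)
    also have "\<dots> = (LINT x|lebesgue. indicator {t<..} x * F x)"
      using Ff' F f_leb by (intro integral_cong_AE) (auto intro!: borel_measurable_times ind)
    also have "\<dots> = (LINT r|?N. indicator {t<..} r * h r)"
      unfolding F_ind by (subst integral_restrict_space) (simp_all add: mult_ac)
    finally show "(LINT x:{t<..}|lborel. f x) = 0"
      using tail by simp
  qed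
  then have "AE x in lebesgue. f x = 0" by (rule AE_completion)
  with Ff' have "AE x in lebesgue. F x = 0" by eventually_elim simp
  then show ?thesis
    by (subst AE_restrict_space_iff) (auto simp: F_def elim!: eventually_mono)
qed

section \<open>Integrability and moments of the kernel transform\<close>

text \<open>Up to the constant \<open>fact n / c ^ Suc n\<close> the integrand is an Erlang density,
  whose total mass is 1.\<close>

lemma has_bochner_integral_power_mult_exp:
  fixes c :: real
  assumes c: "0 < c"
  shows "has_bochner_integral (lebesgue_on {0<..}) (\<lambda>r. r ^ n * exp (- c * r)) (fact n / c ^ Suc n)"
proof -
  have "has_bochner_integral lborel (erlang_density n c) 1"
    using nn_integral_erlang_ith_moment[OF c, of n 0] c
    by (intro has_bochner_integral_nn_integral) auto
  then have "has_bochner_integral lborel (\<lambda>x. fact n / c ^ Suc n * erlang_density n c x) (fact n / c ^ Suc n * 1)"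
    by (rule has_bochner_integral_mult_right)
  \<comment> \<open>The two sides can differ only at 0, which the Erlang density includes in its
    support and the open half-line does not.\<close>
  moreover have "AE x in lborel. fact n / c ^ Suc n * erlang_density n c x
      = indicator {0<..} x *\<^sub>R (x ^ n * exp (- c * x))"
    using AE_lborel_singleton[of 0]
    by eventually_elim (use c in \<open>auto simp: erlang_density_def indicator_def\<close>)
  ultimately have "has_bochner_integral lborel (\<lambda>x. indicator {0<..} x *\<^sub>R (x ^ n * exp (- c * x))) (fact n / c ^ Suc n)"
    by (subst (asm) has_bochner_integral_cong_AE) auto
  then show ?thesis
    by (simp add: has_bochner_integral_iff integrable_restrict_space integral_restrict_space
        integrable_completion integral_completion)
qed

text \<open>Needed for Fubini on the product of the two restricted measures. A countable cover for
  \<open>lborel\<close> also serves its completion.\<close>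

lemma sigma_finite_lebesgue_on:
  fixes S :: "'a::euclidean_space set"
  assumes "S \<in> sets lebesgue"
  shows "sigma_finite_measure (lebesgue_on S)"
proof (rule sigma_finite_measure_restrict_space[OF _ assms])
  obtain C :: "'a set set" where "countable C" "C \<subseteq> sets lborel" "\<Union>C = space lborel" "\<forall>c\<in>C. emeasure lborel c \<noteq> \<infinity>"
    using sigma_finite_measure.sigma_finite_countable[OF sigma_finite_lborel] by metis
  then show "sigma_finite_measure (lebesgue :: 'a measure)"
    by unfold_locales (intro exI[of _ C], auto)
qed


text \<open>For \<open>\<xi> < T\<close> the kernel decays faster than
  \<open>exp (- r / (4 * T))\<close>, so the weight of half that rate leaves decay to spare.
  Integration in \<open>r\<close> cancels the singular factor \<open>1 / (2 * \<xi>)\<close> and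
  leaves \<open>4 * T / (2 * T - \<xi>)\<close>, which is at most 4.\<close>

lemma integrable_exp_kernel:
  fixes v :: "real \<Rightarrow> real"
  assumes T: "0 < T" and v: "integrable (lebesgue_on {0<..<T}) v"
  shows "integrable (lebesgue_on {0<..<T} \<Otimes>\<^sub>M lebesgue_on {0<..})
    (\<lambda>(\<xi>, r). exp (r / (8 * T)) * (1 / (2 * \<xi>) * exp (- r / (4 * \<xi>)) * v \<xi>))"
    (is "integrable (?M \<Otimes>\<^sub>M ?N) (\<lambda>(\<xi>, r). ?f \<xi> r)")
proof -
  interpret M: sigma_finite_measure ?M by (rule sigma_finite_lebesgue_on) simp
  interpret N: sigma_finite_measure ?N by (rule sigma_finite_lebesgue_on) simp
  interpret pair_sigma_finite ?M ?N ..
  have [measurable]: "v \<in> borel_measurable ?M" using v by simp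
  \<comment> \<open>The factor \<open>r ^ 0\<close> gives the integrand the shape of
    \<open>has_bochner_integral_power_mult_exp\<close> with \<open>n = 0\<close>.\<close>
  have f_eq: "?f \<xi> r = v \<xi> / (2 * \<xi>) * (r ^ 0 * exp (- (1 / (4 * \<xi>) - 1 / (8 * T)) * r))" for \<xi> r
    by (simp add: algebra_simps flip: exp_add)
  \<comment> \<open>The coefficient \<open>w\<close> is free, since both \<open>v \<xi>\<close> and
    its absolute value are inserted for it.\<close>
  have inner: "has_bochner_integral ?N (\<lambda>r. w / (2 * \<xi>) * (r ^ 0 * exp (- (1 / (4 * \<xi>) - 1 / (8 * T)) * r)))
      (w * (4 * T / (2 * T - \<xi>)))" if "\<xi> \<in> {0<..<T}" for \<xi> w
  proof -
    have "0 < 1 / (4 * \<xi>) - 1 / (8 * T)"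
      using that T by (simp add: field_simps)
    from has_bochner_integral_mult_right[OF has_bochner_integral_power_mult_exp[OF this, of 0], of "w / (2 * \<xi>)"]
    have "has_bochner_integral ?N (\<lambda>r. w / (2 * \<xi>) * (r ^ 0 * exp (- (1 / (4 * \<xi>) - 1 / (8 * T)) * r)))
      (w / (2 * \<xi>) * (fact 0 / (1 / (4 * \<xi>) - 1 / (8 * T)) ^ Suc 0))" by blast
    moreover have "w / (2 * \<xi>) * (fact 0 / (1 / (4 * \<xi>) - 1 / (8 * T)) ^ Suc 0) = w * (4 * T / (2 * T - \<xi>))"
      using that T by (simp add: field_simps)
    ultimately show ?thesis by simp
  qed
  show ?thesis
  proof (rule Fubini_integrable)
    show "(\<lambda>(\<xi>, r). ?f \<xi> r) \<in> borel_measurable (?M \<Otimes>\<^sub>M ?N)"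
      by measurable
    have "integrable ?M (\<lambda>\<xi>. \<bar>v \<xi>\<bar> * (4 * T / (2 * T - \<xi>)))"
    proof (rule Bochner_Integration.integrable_bound)
      show "integrable ?M (\<lambda>\<xi>. 4 * v \<xi>)" using v by simp
      show "AE \<xi> in ?M. norm (\<bar>v \<xi>\<bar> * (4 * T / (2 * T - \<xi>))) \<le> norm (4 * v \<xi>)"
      proof (rule AE_I2)
        fix \<xi> assume "\<xi> \<in> space ?M"
        then have "\<bar>4 * T / (2 * T - \<xi>)\<bar> \<le> 4" using T by (simp add: field_simps)
        then show "norm (\<bar>v \<xi>\<bar> * (4 * T / (2 * T - \<xi>))) \<le> norm (4 * v \<xi>)"
          using mult_left_mono[of "\<bar>4 * T / (2 * T - \<xi>)\<bar>" 4 "\<bar>v \<xi>\<bar>"] by (simp add: abs_mult mult.commute)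
      qed
    qed measurable
    moreover have "(LINT r|?N. norm (?f \<xi> r)) = \<bar>v \<xi>\<bar> * (4 * T / (2 * T - \<xi>))" if "\<xi> \<in> space ?M" for \<xi>
    proof -
      have \<xi>: "\<xi> \<in> {0<..<T}" using that by simp
      then have "norm (?f \<xi> r) = \<bar>v \<xi>\<bar> / (2 * \<xi>) * (r ^ 0 * exp (- (1 / (4 * \<xi>) - 1 / (8 * T)) * r))" for r
        unfolding f_eq by (simp add: abs_mult)
      then show ?thesis
        using has_bochner_integral_integral_eq[OF inner[OF \<xi>, of "\<bar>v \<xi>\<bar>"]] by simp
    qed
    ultimately show "integrable ?M (\<lambda>\<xi>. LINT r|?N. norm (case (\<xi>, r) of (\<xi>, r) \<Rightarrow> ?f \<xi> r))"
      unfolding prod.case by (subst Bochner_Integration.integrable_cong[OF refl])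
    show "AE \<xi> in ?M. integrable ?N (\<lambda>r. case (\<xi>, r) of (\<xi>, r) \<Rightarrow> ?f \<xi> r)"
    proof (rule AE_I2)
      fix \<xi> assume "\<xi> \<in> space ?M"
      then have "integrable ?N (\<lambda>r. v \<xi> / (2 * \<xi>) * (r ^ 0 * exp (- (1 / (4 * \<xi>) - 1 / (8 * T)) * r)))"
        by (intro integrable.intros[OF inner]) simp
      then show "integrable ?N (\<lambda>r. case (\<xi>, r) of (\<xi>, r) \<Rightarrow> ?f \<xi> r)"
        unfolding prod.case f_eq .
    qed
  qed
qed

text \<open>The weighted kernel dominates its product with \<open>r ^ n\<close>, so Fubini applies.
  The inner integral contributes \<open>fact n * (4 * \<xi>) ^ Suc n\<close>, and one power of
  \<open>\<xi>\<close> cancels against \<open>1 / (2 * \<xi>)\<close>.\<close>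

lemma
  fixes v :: "real \<Rightarrow> real"
  assumes T: "0 < T" and v: "integrable (lebesgue_on {0<..<T}) v"
  defines "Y \<equiv> \<lambda>r. LINT \<xi>|lebesgue_on {0<..<T}. 1 / (2 * \<xi>) * exp (- r / (4 * \<xi>)) * v \<xi>"
  shows integrable_exp_mult_kernel_transform: "integrable (lebesgue_on {0<..}) (\<lambda>r. exp (r / (8 * T)) * Y r)"
    and borel_measurable_kernel_transform: "Y \<in> borel_measurable (lebesgue_on {0<..})"
    and moment_kernel_transform: "(LINT r|lebesgue_on {0<..}. r ^ n * Y r)
      = fact n * 2 ^ (2 * n + 1) * (LINT \<xi>|lebesgue_on {0<..<T}. \<xi> ^ n * v \<xi>)"
proof -
  let ?M = "lebesgue_on {0<..<T}" and ?N = "lebesgue_on {0<..} :: real measure"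
  let ?k = "\<lambda>\<xi> r. 1 / (2 * \<xi>) * exp (- r / (4 * \<xi>)) * v \<xi>"
  interpret M: sigma_finite_measure ?M by (rule sigma_finite_lebesgue_on) simp
  interpret N: sigma_finite_measure ?N by (rule sigma_finite_lebesgue_on) simp
  interpret pair_sigma_finite ?M ?N ..
  have [measurable]: "v \<in> borel_measurable ?M" using v by simp
  note int = integrable_exp_kernel[OF T v]
  show "integrable ?N (\<lambda>r. exp (r / (8 * T)) * Y r)"
    using integrable_snd[OF int] unfolding Y_def by (subst (asm) integral_mult_right_zero)
  show "Y \<in> borel_measurable ?N"
    unfolding Y_def by measurable
  have "integrable (?M \<Otimes>\<^sub>M ?N) (\<lambda>(\<xi>, r). r ^ n * ?k \<xi> r)"
  proof (rule Bochner_Integration.integrable_bound[OF integrable_mult_right[OF int]])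
    show "AE x in ?M \<Otimes>\<^sub>M ?N. norm (case x of (\<xi>, r) \<Rightarrow> r ^ n * ?k \<xi> r)
      \<le> norm (fact n / (1 / (8 * T)) ^ n * (case x of (\<xi>, r) \<Rightarrow> exp (r / (8 * T)) * ?k \<xi> r))"
    proof (rule AE_I2, clarify)
      fix \<xi> r assume "(\<xi>, r) \<in> space (?M \<Otimes>\<^sub>M ?N)"
      then have "0 \<le> r" by (simp add: space_pair_measure)
      \<comment> \<open>Only the weights matter here, so the kernel value is abstracted to an
        arbitrary real \<open>k\<close>.\<close>
      then have "\<bar>r ^ n\<bar> * \<bar>k\<bar> \<le> fact n / (1 / (8 * T)) ^ n * exp (1 / (8 * T) * r) * \<bar>k\<bar>" for k
        using power_le_exp[of "1 / (8 * T)" r n] T by (intro mult_right_mono) auto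
      then have "norm (r ^ n * k) \<le> norm (fact n / (1 / (8 * T)) ^ n * (exp (r / (8 * T)) * k))" for k
        using T by (simp add: abs_mult mult.assoc)
      then show "norm (r ^ n * ?k \<xi> r) \<le> norm (fact n / (1 / (8 * T)) ^ n * (exp (r / (8 * T)) * ?k \<xi> r))" .
    qed
  qed measurable
  then have "(LINT r|?N. LINT \<xi>|?M. r ^ n * ?k \<xi> r) = (LINT \<xi>|?M. LINT r|?N. r ^ n * ?k \<xi> r)"
    by (rule Fubini_integral)
  also have "\<dots> = (LINT \<xi>|?M. fact n * 2 ^ (2 * n + 1) * (\<xi> ^ n * v \<xi>))"
  proof (rule Bochner_Integration.integral_cong)
    fix \<xi> assume "\<xi> \<in> space ?M"
    then have \<xi>: "0 < \<xi>" by simp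
    have "(LINT r|?N. r ^ n * ?k \<xi> r) = (LINT r|?N. v \<xi> / (2 * \<xi>) * (r ^ n * exp (- (1 / (4 * \<xi>)) * r)))"
      by (simp add: mult_ac)
    also have "\<dots> = v \<xi> / (2 * \<xi>) * (fact n / (1 / (4 * \<xi>)) ^ Suc n)"
      using has_bochner_integral_power_mult_exp[of "1 / (4 * \<xi>)" n, THEN has_bochner_integral_integral_eq] \<xi>
      by (subst integral_mult_right_zero) simp
    also have "\<dots> = fact n * (2 * 4 ^ n) * (\<xi> ^ n * v \<xi>)"
      using \<xi> by (simp add: field_simps)
    also have "2 * 4 ^ n = (2 :: real) ^ (2 * n + 1)"
      by (simp add: power_mult)
    finally show "(LINT r|?N. r ^ n * ?k \<xi> r) = fact n * 2 ^ (2 * n + 1) * (\<xi> ^ n * v \<xi>)" .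
  qed simp
  finally show "(LINT r|?N. r ^ n * Y r) = fact n * 2 ^ (2 * n + 1) * (LINT \<xi>|?M. \<xi> ^ n * v \<xi>)"
    unfolding Y_def by (simp only: integral_mult_right_zero)
qed

section \<open>Consequences of essential boundedness\<close>

lemma Linf_space_AE_bound:
  assumes "f \<in> Linf_space S"
  obtains C where "0 \<le> C" "AE x in lebesgue_on S. \<bar>f x\<bar> \<le> C"
proof -
  obtain C where C: "Linf_norm S f \<le> ereal C" "0 \<le> C"
  proof
    \<comment> \<open>Taking \<open>max 0\<close> secures a nonnegative constant. A norm of
      \<open>-\<infinity>\<close>, as on a null set \<open>S\<close>, is sent to 0 by
      \<open>real_of_ereal\<close>.\<close>
    show "Linf_norm S f \<le> ereal (max 0 (real_of_ereal (Linf_norm S f)))"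
      using assms by (cases "Linf_norm S f") (auto simp: Linf_space_def)
  qed simp
  moreover have "AE x in lebesgue_on S. ereal \<bar>f x\<bar> \<le> Linf_norm S f"
    unfolding Linf_norm_def by (rule esssup_AE)
  ultimately have "AE x in lebesgue_on S. \<bar>f x\<bar> \<le> C"
    by (auto elim!: eventually_mono dest: order_trans)
  with C(2) that show ?thesis by blast
qed

lemma integrable_Linf_space:
  assumes S: "S \<in> lmeasurable" and f: "f \<in> Linf_space S"
  shows "integrable (lebesgue_on S) f"
proof -
  interpret finite_measure "lebesgue_on S" using S by (rule finite_measure_lebesgue_on)
  obtain C where "AE x in lebesgue_on S. \<bar>f x\<bar> \<le> C" using Linf_space_AE_bound[OF f] by blast
  then show ?thesis
    using f by (intro integrable_const_bound) (auto simp: Linf_space_def)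
qed

text \<open>Reflection about \<open>T / 2\<close> preserves Lebesgue measure and the interval;
  extension by zero lets it act on the whole line.\<close>

lemma integrable_lebesgue_on_reflect:
  fixes u :: "real \<Rightarrow> real"
  assumes u: "integrable (lebesgue_on {0<..<T}) u"
  shows "integrable (lebesgue_on {0<..<T}) (\<lambda>\<xi>. u (T - \<xi>))"
proof -
  let ?F = "\<lambda>x. indicator {0<..<T} x *\<^sub>R u x"
  have F: "integrable lebesgue ?F"
    using u by (subst (asm) integrable_restrict_space) auto
  have [measurable]: "(\<lambda>x. T - x) \<in> lebesgue \<rightarrow>\<^sub>M lebesgue"
    using lebesgue_affine_measurable[of "\<lambda>_. -1" T] by simp
  have Fm: "?F \<in> borel_measurable lebesgue" using F by simp
  have "integrable lebesgue (\<lambda>x. ?F (T - x))"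
  proof (rule integrableI_bounded)
    show "(\<lambda>x. ?F (T - x)) \<in> borel_measurable lebesgue"
      by (rule measurable_compose[OF _ Fm]) measurable
    have "(\<integral>\<^sup>+x. ennreal (norm (?F (T - x))) \<partial>lebesgue) = (\<integral>\<^sup>+x. ennreal (norm (?F x)) \<partial>lebesgue)"
      using nn_integral_real_affine_lebesgue[of "\<lambda>x. ennreal (norm (?F x))" "-1" T] Fm by simp
    also have "\<dots> < \<infinity>"
      using F unfolding integrable_iff_bounded by blast
    finally show "(\<integral>\<^sup>+x. ennreal (norm (?F (T - x))) \<partial>lebesgue) < \<infinity>" .
  qed
  also have "(\<lambda>x. ?F (T - x)) = (\<lambda>x. indicator {0<..<T} x *\<^sub>R u (T - x))"
    by (auto simp: indicator_def)
  finally show ?thesis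
    by (subst integrable_restrict_space) auto
qed

text \<open>Near 0 the logarithm is unbounded, and square integrability is used instead through
  \<open>\<bar>g r\<bar> \<le> (g r)\<^sup>2 + 1\<close>. Beyond 1 the logarithm is at most
  \<open>4 * T\<close>, so \<open>g\<close> decays like \<open>exp (- r / (4 * T))\<close>, and half
  of that rate survives the weight.\<close>

lemma integrable_exp_mult_of_log_bound:
  fixes g :: "real \<Rightarrow> real"
  assumes T: "0 < T" and g: "g \<in> L2_space {0<..}"
    and bound: "(\<lambda>r. exp (r / (4 * T)) * g r / ln (1 + 4 * T / r)) \<in> Linf_space {0<..}"
  shows "integrable (lebesgue_on {0<..}) (\<lambda>r. exp (r / (8 * T)) * g r)"
proof -
  let ?N = "lebesgue_on {0<..} :: real measure"
  have [measurable]: "g \<in> borel_measurable ?N" and g2: "integrable ?N (\<lambda>r. (g r)\<^sup>2)"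
    using g by (auto simp: L2_space_def)
  obtain C where C: "0 \<le> C" "AE r in ?N. \<bar>exp (r / (4 * T)) * g r / ln (1 + 4 * T / r)\<bar> \<le> C"
    using Linf_space_AE_bound[OF bound] by blast
  \<comment> \<open>The first summand is the majorant on \<open>{0<..1}\<close>, the second the one
    beyond 1. Both are nonnegative, so the sum works on the whole half-line.\<close>
  let ?w = "\<lambda>r. exp (1 / (8 * T)) * ((g r)\<^sup>2 + indicator {0<..1} r) + 4 * T * C * exp (- (1 / (8 * T)) * r)"
  show ?thesis
  proof (rule Bochner_Integration.integrable_bound)
    have "integrable lborel (indicator {0<..1} :: real \<Rightarrow> real)"
      by (simp add: integrable_indicator_iff)
    moreover have "{0<..} \<inter> {0<..1} = {0<..1::real}" by auto
    ultimately have "integrable ?N (indicator {0<..1} :: real \<Rightarrow> real)"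
      by (subst integrable_restrict_space) (auto simp: integrable_completion indicator_inter_arith[symmetric])
    moreover have "integrable ?N (\<lambda>r. exp (- (1 / (8 * T)) * r))"
      using has_bochner_integral_power_mult_exp[of "1 / (8 * T)" 0] T by (simp add: has_bochner_integral_iff)
    ultimately show "integrable ?N ?w"
      using g2 by simp
    show "AE r in ?N. norm (exp (r / (8 * T)) * g r) \<le> norm (?w r)"
      using C(2) AE_space
    proof eventually_elim
      case (elim r)
      then have r: "0 < r" by simp
      have "\<bar>exp (r / (8 * T)) * g r\<bar> \<le> ?w r"
      proof (cases "r \<le> 1")
        case True
        have "2 * \<bar>g r\<bar> \<le> (g r)\<^sup>2 + 1"
          using sum_squares_bound[of "\<bar>g r\<bar>" 1] by simp
        then have "\<bar>g r\<bar> \<le> (g r)\<^sup>2 + 1" by linarith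
        moreover have "exp (r / (8 * T)) \<le> exp (1 / (8 * T))"
          using True T by (simp add: divide_right_mono)
        ultimately have "exp (r / (8 * T)) * \<bar>g r\<bar> \<le> exp (1 / (8 * T)) * ((g r)\<^sup>2 + 1)"
          by (intro mult_mono) auto
        moreover have "0 \<le> 4 * T * C * exp (- (1 / (8 * T)) * r)"
          using T C by simp
        moreover have "?w r = exp (1 / (8 * T)) * ((g r)\<^sup>2 + 1) + 4 * T * C * exp (- (1 / (8 * T)) * r)"
          using True r by simp
        moreover have "\<bar>exp (r / (8 * T)) * g r\<bar> = exp (r / (8 * T)) * \<bar>g r\<bar>"
          by (simp add: abs_mult)
        ultimately show ?thesis
          by linarith
      next
        case False
        let ?l = "ln (1 + 4 * T / r)"
        have "0 < 4 * T / r" using r T by simp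
        then have l: "0 < ?l"
          by (intro ln_gt_zero) simp
        have "?l \<le> 4 * T / r"
          using \<open>0 < 4 * T / r\<close> by (intro ln_add_one_self_le_self) simp
        also have "4 * T / r \<le> 4 * T / 1"
          using False T by (intro divide_left_mono) auto
        finally have l4: "?l \<le> 4 * T" by simp
        have "exp (r / (4 * T)) * \<bar>g r\<bar> \<le> C * ?l"
          using elim(1) l by (simp add: abs_mult field_simps)
        also have "\<dots> \<le> C * (4 * T)"
          using l4 C(1) by (rule mult_left_mono)
        finally have "exp (- (1 / (8 * T)) * r) * (exp (r / (4 * T)) * \<bar>g r\<bar>) \<le> exp (- (1 / (8 * T)) * r) * (C * (4 * T))"
          by (intro mult_left_mono) auto
        moreover have "exp (- (1 / (8 * T)) * r) * exp (r / (4 * T)) = exp (r / (8 * T))"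
          by (simp flip: exp_add)
        ultimately have "exp (r / (8 * T)) * \<bar>g r\<bar> \<le> 4 * T * C * exp (- (1 / (8 * T)) * r)"
          by (metis mult.assoc mult.commute)
        moreover have "0 \<le> exp (1 / (8 * T)) * ((g r)\<^sup>2 + indicator {0<..1} r)" by simp
        moreover have "\<bar>exp (r / (8 * T)) * g r\<bar> = exp (r / (8 * T)) * \<bar>g r\<bar>"
          by (simp add: abs_mult)
        ultimately show ?thesis
          by linarith
      qed
      then show ?case by simp
    qed
  qed measurable
qed

section \<open>Equivalence of the representation and the moment problem\<close>

lemma kernel_transform_eq_iff_moments:
  fixes g u :: "real \<Rightarrow> real"
  assumes T: "0 < T" and gm [measurable]: "g \<in> borel_measurable (lebesgue_on {0<..})"
    and g: "integrable (lebesgue_on {0<..}) (\<lambda>r. exp (r / (8 * T)) * g r)"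
    and v: "integrable (lebesgue_on {0<..<T}) v"
  shows "(AE r in lebesgue_on {0<..}.
      g r = - (1 / pi) * (LINT \<xi>|lebesgue_on {0<..<T}. 1 / (2 * \<xi>) * exp (- r / (4 * \<xi>)) * v \<xi>))
    \<longleftrightarrow> (\<forall>n. (LINT \<xi>|lebesgue_on {0<..<T}. \<xi> ^ n * v \<xi>)
      = - (pi / (2 ^ (2 * n + 1) * fact n)) * (LINT r|lebesgue_on {0<..}. r ^ n * g r))"
proof -
  let ?M = "lebesgue_on {0<..<T}" and ?N = "lebesgue_on {0<..} :: real measure"
  \<comment> \<open>\<open>Y\<close> is taken without the factor \<open>- (1 / pi)\<close>, which
    accounts for the plus sign in \<open>h\<close>.\<close>
  define Y where "Y r = (LINT \<xi>|?M. 1 / (2 * \<xi>) * exp (- r / (4 * \<xi>)) * v \<xi>)" for r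
  define h where "h r = g r + 1 / pi * Y r" for r
  have Y: "integrable ?N (\<lambda>r. exp (r / (8 * T)) * Y r)"
    unfolding Y_def by (rule integrable_exp_mult_kernel_transform[OF T v])
  have [measurable]: "Y \<in> borel_measurable ?N"
    unfolding Y_def by (rule borel_measurable_kernel_transform[OF T v])
  have h [measurable]: "h \<in> borel_measurable ?N"
    unfolding h_def by measurable
  have a: "0 < 1 / (8 * T)" using T by simp
  have "(LINT r|?N. r ^ n * h r) = (LINT r|?N. r ^ n * g r + 1 / pi * (r ^ n * Y r))" for n
    unfolding h_def by (simp add: algebra_simps)
  \<comment> \<open>The preceding equation is general in \<open>n\<close>, so \<open>\<dots>\<close>
    stands for a function of \<open>n\<close> here.\<close>
  also have "\<dots> n = (LINT r|?N. r ^ n * g r)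
      + 1 / pi * (fact n * 2 ^ (2 * n + 1) * (LINT \<xi>|?M. \<xi> ^ n * v \<xi>))" for n
  proof -
    have "integrable ?N (\<lambda>r. r ^ n * g r)" "integrable ?N (\<lambda>r. r ^ n * Y r)"
      using integrable_power_mult_of_exp[OF a] g Y by auto
    then show ?thesis
      using moment_kernel_transform[OF T v, of n] by (simp add: Y_def)
  qed
  finally have moment: "(LINT r|?N. r ^ n * h r) = (LINT r|?N. r ^ n * g r)
      + 1 / pi * (fact n * 2 ^ (2 * n + 1) * (LINT \<xi>|?M. \<xi> ^ n * v \<xi>))" for n .
  have "(AE r in ?N. g r = - (1 / pi) * Y r) \<longleftrightarrow> (AE r in ?N. h r = 0)"
    by (simp add: h_def eq_neg_iff_add_eq_0)
  also have "\<dots> \<longleftrightarrow> (\<forall>n. (LINT r|?N. r ^ n * h r) = 0)"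
  proof
    assume "AE r in ?N. h r = 0"
    then show "\<forall>n. (LINT r|?N. r ^ n * h r) = 0"
      by (auto intro!: integral_eq_zero_AE elim: eventually_mono)
  next
    assume "\<forall>n. (LINT r|?N. r ^ n * h r) = 0"
    moreover have "integrable ?N (\<lambda>r. exp (1 / (8 * T) * r) * h r)"
      using g Y by (simp add: h_def distrib_left)
    ultimately show "AE r in ?N. h r = 0"
      using AE_zero_of_moments_zero[OF a h] by blast
  qed
  also have "\<dots> \<longleftrightarrow> (\<forall>n. (LINT \<xi>|?M. \<xi> ^ n * v \<xi>)
      = - (pi / (2 ^ (2 * n + 1) * fact n)) * (LINT r|?N. r ^ n * g r))"
    unfolding moment by (simp add: field_simps add_eq_0_iff)
  finally show ?thesis unfolding Y_def .
qed

theorem theorem4p5: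
  fixes L T :: real and g :: "real \<Rightarrow> real" and \<gamma> :: "nat \<Rightarrow> real"
  assumes "L > 0" and "T > 0"
    and "g \<in> L2_space {0<..}"
    and "(\<lambda>r. exp (r / (4 * T)) * g r / ln (1 + 4 * T / r)) \<in> Linf_space {0<..}"
    and "\<And>n. \<gamma> n = - (pi / (2 ^ (2 * n + 1) * fact n)) * (LINT r|lebesgue_on {0<..}. r ^ n * g r)"
  shows "g \<in> reachable T L \<longleftrightarrow>
    (\<exists>u \<in> Linf_space {0<..<T}. Linf_norm {0<..<T} u \<le> ereal L \<and>
       (\<forall>n. (LINT \<xi>|lebesgue_on {0<..<T}. \<xi> ^ n * u (T - \<xi>)) = \<gamma> n))"
proof -
  have gm: "g \<in> borel_measurable (lebesgue_on {0<..})"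
    using assms(3) by (simp add: L2_space_def)
  \<comment> \<open>The equivalence holds for each control \<open>u\<close> separately, so the same
    \<open>u\<close> witnesses both sides of the theorem.\<close>
  have "(AE r in lebesgue_on {0<..}. g r = - (1 / pi) * (LINT \<xi>|lebesgue_on {0<..<T}.
                  1 / (2 * \<xi>) * exp (- r / (4 * \<xi>)) * u (T - \<xi>)))
      \<longleftrightarrow> (\<forall>n. (LINT \<xi>|lebesgue_on {0<..<T}. \<xi> ^ n * u (T - \<xi>)) = \<gamma> n)"
    if "u \<in> Linf_space {0<..<T}" for u
    unfolding assms(5)
    by (intro kernel_transform_eq_iff_moments integrable_lebesgue_on_reflect integrable_Linf_space
        integrable_exp_mult_of_log_bound assms gm that) (simp add: bounded_set_imp_lmeasurable)
  then show ?thesis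
    using assms(3) unfolding reachable_def by auto
qed

end
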